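(* Let $(a_n)_{n\ge1}$ be an E-sequence such that (i) $3^n>2^{b_n}$ for all $n\ge1$, where $b_n=\sum_{i=1}^na_i$; and (ii) there is a constant $c>\log_2 3$ such that there are infinitely many distinct pairs $(r,l)$ of positive integers with $l>r$, $b_{l+r}>lc$, and $a_{l+k}=a_k$ for all $1\le k\le r$. Then $(a_n)$ is $\Omega$-divergent.
   Context: An E-sequence is any infinite sequence $(a_n)_{n\ge1}$ of positive integers. For an odd positive integer $x$, its E-sequence is defined by $x_0=x$ and, for $n\ge1$, $x_n=\frac{3x_{n-1}+1}{2^{a_n}}$, where $a_n$ is the exponent of the largest power of $2$ dividing $3x_{n-1}+1$. An E-sequence is $\Omega$-divergent if it is not the E-sequence of any odd positive integer. *)

theory Defs
  imports Complex_Main "HOL-Computational_Algebra.Computational_Algebra"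
begin

text \<open>Sequences $(a_n)_{n \geq 1}$ are functions on \<^typ>\<open>nat\<close> whose value at index 0 is irrelevant.\<close>

definition E_sequence :: "(nat \<Rightarrow> nat) \<Rightarrow> bool" where
  "E_sequence a \<longleftrightarrow> (\<forall>n\<ge>1. a n > 0)"

primrec iterate :: "nat \<Rightarrow> nat \<Rightarrow> nat" where
  "iterate x 0 = x"
| "iterate x (Suc n) =
     (3 * iterate x n + 1) div 2 ^ multiplicity 2 (3 * iterate x n + 1)"

definition E_sequence_of :: "nat \<Rightarrow> nat \<Rightarrow> nat" where
  "E_sequence_of x n = multiplicity 2 (3 * iterate x (n - 1) + 1)"

definition Omega_divergent :: "(nat \<Rightarrow> nat) \<Rightarrow> bool" where
  "Omega_divergent a \<longleftrightarrow>
     \<not> (\<exists>x. x > 0 \<and> odd x \<and> (\<forall>n\<ge>1. a n = E_sequence_of x n))"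

end

theory Submission
  imports Defs "HOL-Real_Asymp.Real_Asymp"
begin

text \<open>
  Suppose that \<open>a\<close> is the E-sequence of \<open>x\<close>, with iterates \<open>x\<^sub>n\<close>. If \<open>x\<^sub>l\<close> and \<open>x\<close> share the
  first \<open>r\<close> terms of their E-sequences, then \<open>2 ^ b r\<close> divides \<open>x\<^sub>l - x\<close>. This difference is positive
  because \<open>3 ^ l > 2 ^ b l\<close>, so \<open>2 ^ b r \<le> x\<^sub>l\<close>. On the other hand \<open>2 ^ b l * x\<^sub>l \<le> 3 ^ l * (x + l)\<close>,
  and \<open>b (l + r) = b l + b r\<close>, whence \<open>2 powr (l * c) < 3 ^ l * (x + l)\<close>. Since \<open>2 powr c > 3\<close>,
  this bounds \<open>l\<close>, and with it \<open>r < l\<close>.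
\<close>

lemma iterate_iterate: "iterate (iterate x l) k = iterate x (l + k)"
  by (induction k) simp_all

text \<open>At \<open>k = 0\<close> the truncated \<open>k - 1\<close> would make the two sides
  refer to different iterates.\<close>

lemma E_sequence_of_iterate:
  "k \<ge> 1 \<Longrightarrow> E_sequence_of (iterate x l) k = E_sequence_of x (l + k)"
  by (simp add: E_sequence_of_def iterate_iterate)

lemma iterate_step: "2 ^ E_sequence_of x (Suc n) * iterate x (Suc n) = 3 * iterate x n + 1"
  by (simp add: E_sequence_of_def multiplicity_dvd dvd_mult_div_cancel del: One_nat_def)

text \<open>Indexed by a starting value, so that it applies to \<open>iterate x l\<close> as well as
  to \<open>x\<close>.\<close>

definition exponent_sum :: "nat \<Rightarrow> nat \<Rightarrow> nat" where
  "exponent_sum x n = (\<Sum>i=1..n. E_sequence_of x i)"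

lemma exponent_sum_0 [simp]: "exponent_sum x 0 = 0"
  by (simp add: exponent_sum_def)

lemma exponent_sum_Suc [simp]:
  "exponent_sum x (Suc n) = exponent_sum x n + E_sequence_of x (Suc n)"
  by (simp add: exponent_sum_def)

lemma exponent_sum_add:
  "exponent_sum x (l + r) = exponent_sum x l + exponent_sum (iterate x l) r"
  by (induction r) (simp_all add: E_sequence_of_iterate)

lemma exponent_sum_cong:
  assumes "\<And>k. 1 \<le> k \<Longrightarrow> k \<le> r \<Longrightarrow> E_sequence_of x k = E_sequence_of y k"
  shows "exponent_sum x r = exponent_sum y r"
  unfolding exponent_sum_def using assms by (intro sum.cong) auto

text \<open>Clearing denominators turns the later bounds and the difference formula into
  division-free inductions.\<close>

lemma iterate_Suc_scaled:
  "2 ^ exponent_sum x (Suc n) * iterate x (Suc n) = 2 ^ exponent_sum x n * (3 * iterate x n + 1)"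
  unfolding exponent_sum_Suc power_add mult.assoc iterate_step ..

lemma iterate_lower: "3 ^ n * x \<le> 2 ^ exponent_sum x n * iterate x n"
proof (induction n)
  case (Suc n)
  then show ?case unfolding iterate_Suc_scaled by (simp add: algebra_simps)
qed simp

text \<open>Each scaled step triples the left side and adds \<open>2 ^ exponent_sum x n\<close>,
  which is at most \<open>3 ^ n\<close> and so fits into the growth of \<open>x + n\<close> by
  one.\<close>

lemma iterate_upper:
  assumes "\<And>n. 2 ^ exponent_sum x n \<le> (3::nat) ^ n"
  shows "2 ^ exponent_sum x n * iterate x n \<le> 3 ^ n * (x + n)"
proof (induction n)
  case (Suc n)
  then show ?case
    unfolding iterate_Suc_scaled using assms[of n] by (simp add: algebra_simps)
qed simp

text \<open>While the exponents agree, the terms \<open>+ 1\<close> cancel in the difference,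
  leaving a factor 3 per step. Integers are used because the difference may be negative.\<close>

lemma iterate_diff:
  assumes "\<And>k. 1 \<le> k \<Longrightarrow> k \<le> r \<Longrightarrow> E_sequence_of x k = E_sequence_of y k"
  shows "2 ^ exponent_sum x r * (int (iterate x r) - int (iterate y r)) = 3 ^ r * (int x - int y)"
  using assms
proof (induction r)
  case (Suc r)
  have scaled: "2 ^ exponent_sum z (Suc r) * int (iterate z (Suc r))
      = 2 ^ exponent_sum z r * (3 * int (iterate z r) + 1)" for z
    using arg_cong[OF iterate_Suc_scaled[of z r], of int]
    by (simp only: of_nat_mult of_nat_add of_nat_power of_nat_numeral of_nat_1)
  have "exponent_sum x (Suc r) = exponent_sum y (Suc r)" "exponent_sum x r = exponent_sum y r"
    using Suc.prems by (auto intro!: exponent_sum_cong)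
  then have "2 ^ exponent_sum x (Suc r) * (int (iterate x (Suc r)) - int (iterate y (Suc r)))
      = 3 * (2 ^ exponent_sum x r * (int (iterate x r) - int (iterate y r)))"
    using scaled[of x] scaled[of y]
    by (simp add: algebra_simps del: iterate.simps exponent_sum_Suc)
  also have "\<dots> = 3 ^ Suc r * (int x - int y)"
    using Suc by simp
  finally show ?case .
qed simp

lemma two_power_exponent_sum_dvd_diff:
  assumes "\<And>k. 1 \<le> k \<Longrightarrow> k \<le> r \<Longrightarrow> E_sequence_of x k = E_sequence_of y k"
  shows "2 ^ exponent_sum x r dvd int x - int y"
proof -
  have "2 ^ exponent_sum x r dvd 3 ^ r * (int x - int y)"
    by (metis iterate_diff[OF assms] dvd_triv_left)
  moreover have "coprime (2 ^ exponent_sum x r) ((3::int) ^ r)"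
    by simp
  ultimately show ?thesis
    by (simp add: coprime_dvd_mult_right_iff)
qed

lemma two_power_exponent_sum_le:
  assumes "x > 0" "l > 0"
    and "\<And>n. n \<ge> 1 \<Longrightarrow> 2 ^ exponent_sum x n < (3::nat) ^ n"
    and rep: "\<And>k. 1 \<le> k \<Longrightarrow> k \<le> r \<Longrightarrow> E_sequence_of x (l + k) = E_sequence_of x k"
  shows "2 ^ exponent_sum x (l + r) \<le> 3 ^ l * (x + l)"
proof -
  let ?y = "iterate x l"
  have agree: "E_sequence_of ?y k = E_sequence_of x k" if "1 \<le> k" "k \<le> r" for k
    using that rep by (simp add: E_sequence_of_iterate)
  \<comment> \<open>Strictness here makes \<open>?y - x\<close> positive, so that divisibility will
    yield a lower bound on it.\<close>
  have "2 ^ exponent_sum x l * x < 3 ^ l * x"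
    using assms by simp
  also have "\<dots> \<le> 2 ^ exponent_sum x l * ?y"
    by (rule iterate_lower)
  finally have "x < ?y"
    by simp
  moreover have "2 ^ exponent_sum ?y r dvd int ?y - int x"
    using agree by (rule two_power_exponent_sum_dvd_diff)
  ultimately have "2 ^ exponent_sum ?y r \<le> int ?y - int x"
    by (intro zdvd_imp_le) auto
  then have "int (2 ^ exponent_sum ?y r) \<le> int ?y"
    unfolding of_nat_power of_nat_numeral by linarith
  then have "2 ^ exponent_sum ?y r \<le> ?y"
    by (simp only: of_nat_le_iff)
  then have "2 ^ exponent_sum x (l + r) \<le> 2 ^ exponent_sum x l * ?y"
    by (simp add: exponent_sum_add power_add)
  also have "\<dots> \<le> 3 ^ l * (x + l)"
  proof (rule iterate_upper)
    show "2 ^ exponent_sum x n \<le> (3::nat) ^ n" for n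
      using assms(3)[of n] by (cases "n = 0") auto
  qed
  finally show ?thesis .
qed

theorem theorem4p13:
  fixes a b :: "nat \<Rightarrow> nat"
  assumes "E_sequence a"
    and "\<And>n. b n = (\<Sum>i=1..n. a i)"
    and "\<And>n. n \<ge> 1 \<Longrightarrow> (3::nat) ^ n > 2 ^ b n"
    and "\<exists>c::real. c > log 2 3 \<and>
           infinite {(r::nat, l::nat). r > 0 \<and> l > 0 \<and> l > r \<and>
             real (b (l + r)) > real l * c \<and>
             (\<forall>k. 1 \<le> k \<and> k \<le> r \<longrightarrow> a (l + k) = a k)}"
  shows "Omega_divergent a"
  unfolding Omega_divergent_def
proof
  assume "\<exists>x. x > 0 \<and> odd x \<and> (\<forall>n\<ge>1. a n = E_sequence_of x n)"
  then obtain x where "x > 0" and a: "\<And>n. n \<ge> 1 \<Longrightarrow> a n = E_sequence_of x n"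
    by blast
  obtain c :: real where c: "c > log 2 3" and inf:
    "infinite {(r::nat, l::nat). r > 0 \<and> l > 0 \<and> l > r \<and>
       real (b (l + r)) > real l * c \<and> (\<forall>k. 1 \<le> k \<and> k \<le> r \<longrightarrow> a (l + k) = a k)}"
    (is "infinite ?S")
    using assms(4) by blast
  have b: "b n = exponent_sum x n" for n
    unfolding assms(2) exponent_sum_def using a by (intro sum.cong) auto
  \<comment> \<open>Chosen so that \<open>3 ^ l * q ^ l = 2 powr (l * c)\<close>. As
    \<open>q > 1\<close>, its powers eventually exceed the linear term \<open>x + l\<close>, from a
    threshold \<open>N\<close> independent of \<open>r\<close>.\<close>
  define q where "q = 2 powr c / 3"
  have "2 powr log 2 3 < 2 powr c"
    using c by (intro powr_less_mono) auto
  then have "q > 1"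
    by (simp add: q_def)
  then have "eventually (\<lambda>l::nat. real x + real l < q ^ l) sequentially"
    by real_asymp
  then obtain N where N: "\<And>l. l \<ge> N \<Longrightarrow> real x + real l < q ^ l"
    by (auto simp: eventually_sequentially)
  have "l < N" if "l > 0" and len: "real (b (l + r)) > real l * c"
    and rep: "\<And>k. 1 \<le> k \<Longrightarrow> k \<le> r \<Longrightarrow> a (l + k) = a k" for l r
  proof -
    have "2 ^ exponent_sum x (l + r) \<le> 3 ^ l * (x + l)"
    proof (rule two_power_exponent_sum_le)
      show "2 ^ exponent_sum x n < (3::nat) ^ n" if "n \<ge> 1" for n
        using assms(3)[OF that] by (simp add: b)
      show "E_sequence_of x (l + k) = E_sequence_of x k" if "1 \<le> k" "k \<le> r" for k
        using rep[OF that] a that by simp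
    qed fact+
    then have "real (2 ^ b (l + r)) \<le> real (3 ^ l * (x + l))"
      unfolding b of_nat_le_iff .
    then have upper: "(2::real) ^ b (l + r) \<le> 3 ^ l * (real x + real l)"
      by simp
    have "3 ^ l * q ^ l = (2 powr c) ^ l"
      by (simp add: q_def power_divide)
    also have "\<dots> = 2 powr (real l * c)"
      by (simp add: powr_power mult.commute)
    also have "\<dots> < 2 powr real (b (l + r))"
      using len by simp
    also have "\<dots> = 2 ^ b (l + r)"
      by (simp add: powr_realpow)
    also note upper
    finally have "q ^ l < real x + real l"
      by simp
    then show ?thesis
      using N[of l] by (meson not_less less_asym)
  qed
  \<comment> \<open>The bound on \<open>l\<close> also bounds \<open>r\<close>, since
    \<open>r < l\<close>.\<close>
  then have "?S \<subseteq> {..<N} \<times> {..<N}"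
    by (auto intro: less_trans)
  then show False
    using inf finite_subset by blast
qed

end
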